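(* Consider the linear regression model $y=X\theta+u$ (context). Suppose that for a given $i\ge1$ with $i\le k=k(n)$ for all large enough $n$ we have $\xi_{i,n}\eta_{i,n}\to0$, $n-k\to\infty$, and $n^{1/2}\eta_{i,n}/(n-k)^{1/2}\to0$. Let $a_{i,n}$ be any sequence of non-negative reals, $E_{H,i,n}=[\tilde\theta_{H,i}-\hat\sigma a_{i,n},\tilde\theta_{H,i}+\hat\sigma a_{i,n}]$ and $C_{H,i,n}=[\hat\theta_{H,i}-\sigma a_{i,n},\hat\theta_{H,i}+\sigma a_{i,n}]$. Then, for any $\sigma>0$, $$\inf_{\theta\in\mathbb{R}^k,\sigma'\in(0,\infty)}P_{n,\theta,\sigma'}(\theta_i\in E_{H,i,n})-\inf_{\theta\in\mathbb{R}^k}P_{n,\theta,\sigma}(\theta_i\in C_{H,i,n})\longrightarrow0\quad(n\to\infty).$$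
   Context: Model: for each $n$, $y=X\theta+u$ with $y\in\mathbb{R}^n$, $X$ a non-stochastic $n\times k$ matrix of rank $k\ge1$ ($k=k(n)$ and all entries may depend on $n$), $\theta\in\mathbb{R}^k$, $u\sim N(0,\sigma^2I_n)$, $\sigma>0$. $P_{n,\theta,\sigma}$ is the probability under $(\theta,\sigma)$. $\hat\theta_{LS}=(X'X)^{-1}X'y$, $\hat\sigma^2=(y-X\hat\theta_{LS})'(y-X\hat\theta_{LS})/(n-k)$ (for $n>k$), $\xi_{i,n}\ge0$ with $\xi_{i,n}^2=((X'X/n)^{-1})_{ii}$. Standing assumption for asymptotic results: $\sup_n\xi_{i,n}^2/n<\infty$. Tuning parameters $\eta_{i,n}>0$. Hard-thresholding: known-variance $\hat\theta_{H,i}=\hat\theta_{LS,i}\mathbf{1}(|\hat\theta_{LS,i}|>\sigma\xi_{i,n}\eta_{i,n})$, feasible $\tilde\theta_{H,i}=\hat\theta_{LS,i}\mathbf{1}(|\hat\theta_{LS,i}|>\hat\sigma\xi_{i,n}\eta_{i,n})$. *)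

theory Defs
  imports "HOL-Probability.Probability" "Jordan_Normal_Form.Gauss_Jordan_Elimination"
    "Jordan_Normal_Form.DL_Rank"
begin

text \<open>Design matrices: X n is an n x k(n) real matrix (Jordan_Normal_Form matrices).
  Observations y are elements of real vec of dimension n. Indices are 0-based.\<close>

definition XtX_inv :: "real mat \<Rightarrow> real mat" where
  "XtX_inv A = the (mat_inverse (transpose_mat A * A))"

definition theta_LS :: "real mat \<Rightarrow> real vec \<Rightarrow> real vec" where
  "theta_LS A y = XtX_inv A *\<^sub>v (transpose_mat A *\<^sub>v y)"

definition sigma_hat :: "real mat \<Rightarrow> real vec \<Rightarrow> real" where
  "sigma_hat A y = sqrt (((y - A *\<^sub>v theta_LS A y) \<bullet> (y - A *\<^sub>v theta_LS A y))
                        / (real (dim_row A) - real (dim_col A)))"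

definition xi :: "real mat \<Rightarrow> nat \<Rightarrow> real" where
  "xi A i = sqrt (the (mat_inverse ((1 / real (dim_row A)) \<cdot>\<^sub>m (transpose_mat A * A))) $$ (i, i))"

definition theta_H :: "real mat \<Rightarrow> real \<Rightarrow> real \<Rightarrow> nat \<Rightarrow> real vec \<Rightarrow> real" where
  "theta_H A eta sig i y =
     (if \<bar>theta_LS A y $ i\<bar> > sig * xi A i * eta then theta_LS A y $ i else 0)"

definition theta_H_feas :: "real mat \<Rightarrow> real \<Rightarrow> nat \<Rightarrow> real vec \<Rightarrow> real" where
  "theta_H_feas A eta i y =
     (if \<bar>theta_LS A y $ i\<bar> > sigma_hat A y * xi A i * eta then theta_LS A y $ i else 0)"

text \<open>P_{n,theta,sig}: law of y = X theta + u, u ~ N(0, sig^2 I_n), as a measure on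
  functions {..<n} -> real (independent normal coordinates with means (X theta)_j).\<close>
definition P_model :: "real mat \<Rightarrow> real vec \<Rightarrow> real \<Rightarrow> (nat \<Rightarrow> real) measure" where
  "P_model A theta sig =
     PiM {..<dim_row A} (\<lambda>j. density lborel (normal_density ((A *\<^sub>v theta) $ j) sig))"

definition cover_E :: "real mat \<Rightarrow> real \<Rightarrow> real \<Rightarrow> nat \<Rightarrow> real vec \<Rightarrow> real \<Rightarrow> real" where
  "cover_E A eta a i theta sig' =
     measure (P_model A theta sig')
       {y \<in> space (P_model A theta sig').
          theta $ i \<in> {theta_H_feas A eta i (vec (dim_row A) y) - sigma_hat A (vec (dim_row A) y) * a
                     .. theta_H_feas A eta i (vec (dim_row A) y) + sigma_hat A (vec (dim_row A) y) * a}}"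

definition cover_C :: "real mat \<Rightarrow> real \<Rightarrow> real \<Rightarrow> nat \<Rightarrow> real vec \<Rightarrow> real \<Rightarrow> real" where
  "cover_C A eta a i theta sig =
     measure (P_model A theta sig)
       {y \<in> space (P_model A theta sig).
          theta $ i \<in> {theta_H A eta sig i (vec (dim_row A) y) - sig * a
                     .. theta_H A eta sig i (vec (dim_row A) y) + sig * a}}"

end

theory Submission
  imports Defs
begin

text \<open>Put \<open>W = (theta_LS - theta) / (sig * b)\<close> with \<open>b = xi / sqrt n\<close>, \<open>s = sigma_hat / sig\<close>,
  \<open>T = sqrt n * eta\<close>, \<open>\<alpha> = a / b\<close> and \<open>v = theta / (sig * b)\<close>, all at the index \<open>i\<close>. Then \<open>W\<close> is standard
  normal, and coverage becomes an event in \<open>W\<close>, \<open>s\<close> and \<open>v\<close>, with \<open>s = 1\<close> in the known-variance case.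
  If \<open>s\<close> is within \<open>\<delta>\<close> of 1 with high probability, sandwiching \<open>s\<close> between \<open>1 - \<delta>\<close> and
  \<open>1 + \<delta>\<close> shows that for every \<open>v\<close> the coverage is at least
  \<open>max 0 (\<Phi> \<alpha> - \<Phi> (T - \<alpha>))\<close> up to an error of order \<open>\<delta> * (1 + T)\<close>, and that a \<open>v\<close> just
  above \<open>(1 + \<delta>) * \<alpha>\<close> nearly attains this value. The errors are uniform in \<open>\<alpha>\<close> because the
  normal distribution function \<open>\<Phi>\<close> is Lipschitz and satisfies \<open>\<bar>\<Phi> (c * x) - \<Phi> x\<bar> \<le> \<bar>c - 1\<bar>\<close> for \<open>c \<ge> 1/2\<close> and all \<open>x\<close>; independence of \<open>W\<close> and \<open>s\<close>
  plays no role. Chebyshev's inequality for the residual sum of squares allows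
  \<open>\<delta> = c / sqrt (n - k)\<close> with exceptional probability \<open>2 / c\<^sup>2\<close>, and \<open>\<delta> * T\<close> tends to 0 for fixed \<open>c\<close>.\<close>

subsection \<open>Standardized coverage\<close>

lemma std_normal_interval_le:
  assumes "x \<le> y" "0 \<le> B" and bnd: "\<And>t. x < t \<Longrightarrow> t \<le> y \<Longrightarrow> std_normal_density t \<le> B"
  shows "measure std_normal_distribution {x<..y} \<le> B * (y - x)"
proof -
  have "emeasure std_normal_distribution {x<..y} = (\<integral>\<^sup>+t. ennreal (std_normal_density t) * indicator {x<..y} t \<partial>lborel)"
    by (subst emeasure_density) auto
  also have "\<dots> \<le> (\<integral>\<^sup>+t. ennreal B * indicator {x<..y} t \<partial>lborel)"
    by (intro nn_integral_mono) (auto simp: indicator_def intro!: ennreal_leI bnd)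
  also have "\<dots> = ennreal (B * (y - x))"
    using assms(1,2) by (subst nn_integral_cmult) (auto simp: ennreal_mult)
  finally show ?thesis
    using assms(1,2) by (simp add: measure_def enn2real_leI)
qed

lemma cdf_std_normal_diff: "x \<le> y \<Longrightarrow> cdf std_normal_distribution y - cdf std_normal_distribution x = measure std_normal_distribution {x<..y}"
proof -
  interpret prob_space std_normal_distribution by (rule prob_space_normal_density) simp
  assume "x \<le> y"
  have "{..y} = {..x} \<union> {x<..y}" using \<open>x \<le> y\<close> by auto
  then have "measure std_normal_distribution {..y} = measure std_normal_distribution {..x} + measure std_normal_distribution {x<..y}"
    using finite_measure_Union[of "{..x}" "{x<..y}"] by (simp add: ivl_disj_int)
  then show ?thesis by (simp add: cdf_def)
qed

text \<open>The crude constant uses only \<open>pi \<ge> 2\<close>; it suffices for the constant 1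
  in both the Lipschitz and the scaling bound.\<close>

lemma std_normal_density_le: "std_normal_density t \<le> exp (- t\<^sup>2 / 2) / sqrt 2"
proof -
  have "1 / sqrt (2 * pi) \<le> 1 / sqrt 2"
    using pi_ge_two by (intro divide_left_mono) auto
  from mult_right_mono[OF this, of "exp (- t\<^sup>2 / 2)"] show ?thesis
    by (simp add: std_normal_density_def)
qed

lemma cdf_std_normal_mono: "x \<le> y \<Longrightarrow> cdf std_normal_distribution x \<le> cdf std_normal_distribution y"
  using cdf_std_normal_diff[of x y] measure_nonneg[of std_normal_distribution "{x<..y}"] by linarith

lemma cdf_std_normal_lipschitz:
  assumes "x \<le> y" shows "cdf std_normal_distribution y \<le> cdf std_normal_distribution x + (y - x)"
proof -
  have "std_normal_density t \<le> 1" for t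
  proof -
    have "exp (- t\<^sup>2 / 2) \<le> 1" "1 \<le> sqrt (2::real)" by simp_all
    then have "exp (- t\<^sup>2 / 2) \<le> sqrt 2" by (rule order_trans)
    then have "exp (- t\<^sup>2 / 2) / sqrt 2 \<le> 1" by simp
    then show ?thesis using std_normal_density_le[of t] by linarith
  qed
  then have "measure std_normal_distribution {x<..y} \<le> 1 * (y - x)"
    using assms by (intro std_normal_interval_le) auto
  then show ?thesis using cdf_std_normal_diff[OF assms] by simp
qed

text \<open>Points between \<open>x\<close> and \<open>c * x\<close> lie on one side of 0, at
  distance at least \<open>\<bar>x\<bar> / 2\<close> from it. The density there is at most
  \<open>exp (- x^2 / 8) / sqrt 2\<close>, and this decay absorbs the factor
  \<open>\<bar>x\<bar>\<close> in the interval length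
  \<open>\<bar>c - 1\<bar> * \<bar>x\<bar>\<close>.\<close>

lemma cdf_std_normal_scale:
  assumes c: "1 / 2 \<le> c"
  shows "\<bar>cdf std_normal_distribution (c * x) - cdf std_normal_distribution x\<bar> \<le> \<bar>c - 1\<bar>"
proof -
  \<comment> \<open>\<open>z\<close> and \<open>y\<close> stand for \<open>x\<close> and
    \<open>c * x\<close> in increasing order, so one claim serves both orders.\<close>
  have step: "cdf std_normal_distribution y - cdf std_normal_distribution z \<le> \<bar>c - 1\<bar>"
    if zy: "z \<le> y" and d: "y - z = \<bar>c - 1\<bar> * \<bar>x\<bar>" and t: "\<And>t. z < t \<Longrightarrow> t \<le> y \<Longrightarrow> \<bar>x\<bar> \<le> 2 * \<bar>t\<bar>" for y z
  proof -
    let ?B = "exp (- (x\<^sup>2 / 8)) / sqrt 2"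
    have "std_normal_density t \<le> ?B" if "z < t" "t \<le> y" for t
    proof -
      have "x\<^sup>2 \<le> (2 * t)\<^sup>2" using t[OF that] by (subst abs_le_square_iff[symmetric]) (simp add: abs_mult)
      then have "exp (- t\<^sup>2 / 2) \<le> exp (- (x\<^sup>2 / 8))" by (simp add: power_mult_distrib)
      then have "exp (- t\<^sup>2 / 2) / sqrt 2 \<le> ?B" by (intro divide_right_mono) auto
      then show ?thesis using std_normal_density_le[of t] by linarith
    qed
    then have "measure std_normal_distribution {z<..y} \<le> ?B * (y - z)"
      using zy by (intro std_normal_interval_le) auto
    also have "\<dots> = \<bar>c - 1\<bar> * (?B * \<bar>x\<bar>)" using d by simp
    also have "?B * \<bar>x\<bar> \<le> 1"
    proof -
      \<comment> \<open>With \<open>u = \<bar>x\<bar> / sqrt 8\<close> this yields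
        \<open>2 * u \<le> 1 + u^2 \<le> exp (u^2)\<close>.\<close>
      have "0 \<le> (\<bar>x\<bar> / sqrt 8 - 1)\<^sup>2" by simp
      then have "2 * (\<bar>x\<bar> / sqrt 8) \<le> 1 + x\<^sup>2 / 8"
        by (simp add: power2_diff power_divide)
      also have "\<dots> \<le> exp (x\<^sup>2 / 8)" by (rule exp_ge_add_one_self)
      finally have "2 * \<bar>x\<bar> / sqrt 8 \<le> exp (x\<^sup>2 / 8)" by simp
      moreover have "sqrt 8 = 2 * sqrt (2::real)"
        using real_sqrt_mult[of 4 2] by simp
      ultimately have "\<bar>x\<bar> / sqrt 2 \<le> exp (x\<^sup>2 / 8)" by simp
      then have "exp (- (x\<^sup>2 / 8)) * (\<bar>x\<bar> / sqrt 2) \<le> exp (- (x\<^sup>2 / 8)) * exp (x\<^sup>2 / 8)"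
        by (intro mult_left_mono) auto
      then show ?thesis by (simp add: exp_add[symmetric])
    qed
    then have "\<bar>c - 1\<bar> * (?B * \<bar>x\<bar>) \<le> \<bar>c - 1\<bar> * 1" by (intro mult_left_mono) auto
    finally show ?thesis using cdf_std_normal_diff[OF zy] by simp
  qed
  have cx: "\<bar>x\<bar> \<le> 2 * \<bar>c * x\<bar>"
    using mult_right_mono[OF c, of "\<bar>x\<bar>"] c by (simp add: abs_mult)
  have diff: "c * x - x = (c - 1) * x" by (simp add: algebra_simps)
  have same: "0 \<le> c * x \<longleftrightarrow> 0 \<le> x" using c by (simp add: zero_le_mult_iff)
  show ?thesis
  proof (cases "x \<le> c * x")
    case True
    have "cdf std_normal_distribution (c * x) - cdf std_normal_distribution x \<le> \<bar>c - 1\<bar>"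
    proof (rule step)
      show "c * x - (x) = \<bar>c - 1\<bar> * \<bar>x\<bar>" using diff True by (simp add: abs_mult[symmetric])
      fix t assume "x < t" "t \<le> c * x"
      then show "\<bar>x\<bar> \<le> 2 * \<bar>t\<bar>" using cx same by linarith
    qed (use True in simp)
    then show ?thesis using cdf_std_normal_mono[OF True] by linarith
  next
    case False
    then have F: "c * x \<le> x" by simp
    have "cdf std_normal_distribution x - cdf std_normal_distribution (c * x) \<le> \<bar>c - 1\<bar>"
    proof (rule step)
      show "x - (c * x) = \<bar>c - 1\<bar> * \<bar>x\<bar>" using diff F by (simp add: abs_mult[symmetric])
      fix t assume "c * x < t" "t \<le> x"
      then show "\<bar>x\<bar> \<le> 2 * \<bar>t\<bar>" using cx same by linarith
    qed (use F in simp)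
    then show ?thesis using cdf_std_normal_mono[OF F] by linarith
  qed
qed

text \<open>Coverage in standardized form: \<open>w\<close> is the estimation error, \<open>v\<close> the parameter, and \<open>s\<close> the ratio
  of the scale used by the procedure to the true one.\<close>
definition hit :: "real \<Rightarrow> real \<Rightarrow> real \<Rightarrow> real \<Rightarrow> real \<Rightarrow> bool" where
  "hit T \<alpha> v s w \<longleftrightarrow> (if \<bar>w + v\<bar> > s * T then \<bar>w\<bar> \<le> s * \<alpha> else \<bar>v\<bar> \<le> s * \<alpha>)"

text \<open>The infimum over \<open>v\<close> of the coverage probability for \<open>s = 1\<close>; it is approached as \<open>v\<close> decreases to \<open>\<alpha>\<close>.\<close>
definition limit_cover :: "real \<Rightarrow> real \<Rightarrow> real" where
  "limit_cover T \<alpha> = max 0 (cdf std_normal_distribution \<alpha> - cdf std_normal_distribution (T - \<alpha>))"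

section \<open>Comparison of hits with intervals for the estimation error\<close>

lemma hit_uminus: "hit T \<alpha> (- v) s (- w) \<longleftrightarrow> hit T \<alpha> v s w"
  by (simp add: hit_def abs_if)

text \<open>A retained estimate hits because
  \<open>\<bar>w\<bar> \<le> (1 - \<delta>) * \<alpha>\<close>. A thresholded one has
  \<open>w + v \<le> s * T\<close>, and the lower bound on \<open>w\<close> then forces
  \<open>v \<le> (1 - \<delta>) * \<alpha>\<close>. One interval for \<open>w\<close> thus serves
  all \<open>v \<ge> 0\<close>.\<close>

lemma hit_scale_mono:
  assumes "1 - \<delta> \<le> s" "s \<le> 1 + \<delta>" "\<delta> \<le> 1 / 2" "0 < T" "0 \<le> \<alpha>" "0 \<le> v"
    and w: "(1 + \<delta>) * T - (1 - \<delta>) * \<alpha> < w" "w \<le> (1 - \<delta>) * \<alpha>"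
  shows "hit T \<alpha> v s w"
proof -
  have 1: "(1 - \<delta>) * \<alpha> \<le> s * \<alpha>" using assms by (intro mult_right_mono) auto
  have 2: "s * T \<le> (1 + \<delta>) * T" using assms by (intro mult_right_mono) auto
  have 3: "0 \<le> s * T" using assms by auto
  have "\<bar>w\<bar> \<le> (1 - \<delta>) * \<alpha>" using w 2 3 by linarith
  then show ?thesis using 1 2 3 w \<open>0 \<le> v\<close> unfolding hit_def by (auto simp: abs_if split: if_splits)
qed

text \<open>This \<open>v\<close> exceeds \<open>s * \<alpha>\<close>, strictly thanks to the
  summand \<open>\<delta>\<close>, so an estimate set to 0 misses. A hit needs
  \<open>\<bar>w + v\<bar> > s * T\<close> and \<open>\<bar>w\<bar> \<le> s * \<alpha>\<close>; the
  latter makes \<open>w + v\<close> positive.\<close>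

lemma hit_far:
  assumes "1 - \<delta> \<le> s" "s \<le> 1 + \<delta>" "0 < \<delta>" "\<delta> \<le> 1 / 2" "0 < T" "0 \<le> \<alpha>"
    and h: "hit T \<alpha> ((1 + \<delta>) * \<alpha> + \<delta>) s w"
  shows "(1 - \<delta>) * T - ((1 + \<delta>) * \<alpha> + \<delta>) < w \<and> w \<le> (1 + \<delta>) * \<alpha>"
proof -
  have 1: "s * \<alpha> \<le> (1 + \<delta>) * \<alpha>" using assms by (intro mult_right_mono) auto
  have 2: "(1 - \<delta>) * T \<le> s * T" using assms by (intro mult_right_mono) auto
  have 3: "0 \<le> s * T" "0 \<le> (1 + \<delta>) * \<alpha>" using assms by auto
  show ?thesis using 1 2 3 h assms(3) unfolding hit_def by (auto simp: abs_if split: if_splits)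
qed

section \<open>Coverage probabilities when the scale ratio is close to 1\<close>

context prob_space
begin

lemma std_normal_prob_interval:
  assumes W: "distributed M lborel W std_normal_density"
  shows "prob {\<omega> \<in> space M. x < W \<omega> \<and> W \<omega> \<le> y} = max 0 (cdf std_normal_distribution y - cdf std_normal_distribution x)"
proof -
  have [measurable]: "W \<in> borel_measurable M" using distributed_measurable[OF W] by simp
  have "prob {\<omega> \<in> space M. x < W \<omega> \<and> W \<omega> \<le> y} = measure (distr M lborel W) {x<..y}"
    by (subst measure_distr) (auto simp: vimage_def Int_def conj_commute)
  also have "\<dots> = measure std_normal_distribution {x<..y}"
    using distributed_distr_eq_density[OF W] by simp
  also have "\<dots> = max 0 (cdf std_normal_distribution y - cdf std_normal_distribution x)"
  proof (cases "x \<le> y")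
    case True then show ?thesis using cdf_std_normal_diff[OF True] measure_nonneg[of std_normal_distribution "{x<..y}"] by linarith
  next
    case False then show ?thesis using cdf_std_normal_mono[of y x] by (simp add: max_def)
  qed
  finally show ?thesis .
qed

lemma hit_measurable [measurable]:
  assumes [measurable]: "W \<in> borel_measurable M" "s \<in> borel_measurable M"
  shows "{\<omega> \<in> space M. hit T \<alpha> v (s \<omega>) (W \<omega>)} \<in> events"
  unfolding hit_def by measurable

text \<open>Discarding the event that \<open>s\<close> is off by more than \<open>\<delta>\<close>
  costs \<open>p\<close>; otherwise an interval for \<open>W\<close> forces a hit. Scaling its two
  end points costs \<open>\<delta>\<close> each, the remaining shift
  \<open>2 * \<delta> * T\<close>. The 3 matches the upper bound.\<close>

lemma prob_hit_lower_nonneg: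
  assumes W: "distributed M lborel W std_normal_density"
    and s[measurable]: "s \<in> borel_measurable M"
    and p: "prob {\<omega> \<in> space M. \<bar>s \<omega> - 1\<bar> > \<delta>} \<le> p"
    and d: "0 < \<delta>" "\<delta> \<le> 1 / 2" and T: "0 < T" and a: "0 \<le> \<alpha>" and v: "0 \<le> v"
  shows "limit_cover T \<alpha> - (p + \<delta> * (3 + 2 * T)) \<le> prob {\<omega> \<in> space M. hit T \<alpha> v (s \<omega>) (W \<omega>)}"
proof -
  have [measurable]: "W \<in> borel_measurable M" using distributed_measurable[OF W] by simp
  let ?I = "{\<omega> \<in> space M. (1 + \<delta>) * T - (1 - \<delta>) * \<alpha> < W \<omega> \<and> W \<omega> \<le> (1 - \<delta>) * \<alpha>}"
  let ?B = "{\<omega> \<in> space M. \<bar>s \<omega> - 1\<bar> > \<delta>}"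
  let ?H = "{\<omega> \<in> space M. hit T \<alpha> v (s \<omega>) (W \<omega>)}"
  have "?I \<subseteq> ?H \<union> ?B"
    using hit_scale_mono[of \<delta> _ T \<alpha> v] d T a v by (auto simp: abs_le_iff not_less)
  then have "prob ?I \<le> prob (?H \<union> ?B)" by (intro finite_measure_mono) auto
  also have "\<dots> \<le> prob ?H + prob ?B" by (intro measure_Un_le) auto
  finally have "prob ?I \<le> prob ?H + p" using p by linarith
  moreover have "prob ?I = max 0 (cdf std_normal_distribution ((1 - \<delta>) * \<alpha>) - cdf std_normal_distribution ((1 + \<delta>) * T - (1 - \<delta>) * \<alpha>))"
    by (rule std_normal_prob_interval[OF W])
  moreover have "\<bar>cdf std_normal_distribution ((1 - \<delta>) * \<alpha>) - cdf std_normal_distribution \<alpha>\<bar> \<le> \<delta>"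
    using cdf_std_normal_scale[of "1 - \<delta>" \<alpha>] d by simp
  moreover have "\<bar>cdf std_normal_distribution ((1 - \<delta>) * (T - \<alpha>)) - cdf std_normal_distribution (T - \<alpha>)\<bar> \<le> \<delta>"
    using cdf_std_normal_scale[of "1 - \<delta>" "T - \<alpha>"] d by simp
  \<comment> \<open>The end point equals
    \<open>(1 - \<delta>) * (T - \<alpha>) + 2 * \<delta> * T\<close>. The scaling bound handles the
    factor uniformly in \<open>\<alpha>\<close>, and the Lipschitz bound is spent only on the shift,
    which is free of \<open>\<alpha>\<close>.\<close>
  moreover have "cdf std_normal_distribution ((1 + \<delta>) * T - (1 - \<delta>) * \<alpha>) \<le> cdf std_normal_distribution ((1 - \<delta>) * (T - \<alpha>)) + 2 * \<delta> * T"
    using cdf_std_normal_lipschitz[of "(1 - \<delta>) * (T - \<alpha>)" "(1 + \<delta>) * T - (1 - \<delta>) * \<alpha>"] d T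
    by (simp add: algebra_simps)
  moreover have "0 \<le> p" using p measure_nonneg[of M ?B] by linarith
  moreover have "0 \<le> prob ?H" by simp
  moreover have "0 \<le> \<delta> * T" using d T by simp
  ultimately show ?thesis using d unfolding limit_cover_def by (simp add: algebra_simps)
qed

lemma prob_hit_lower:
  assumes W: "distributed M lborel W std_normal_density"
    and s: "s \<in> borel_measurable M"
    and p: "prob {\<omega> \<in> space M. \<bar>s \<omega> - 1\<bar> > \<delta>} \<le> p"
    and d: "0 < \<delta>" "\<delta> \<le> 1 / 2" and T: "0 < T" and a: "0 \<le> \<alpha>"
  shows "limit_cover T \<alpha> - (p + \<delta> * (3 + 2 * T)) \<le> prob {\<omega> \<in> space M. hit T \<alpha> v (s \<omega>) (W \<omega>)}"
proof (cases "0 \<le> v")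
  case True then show ?thesis using assms by (intro prob_hit_lower_nonneg) auto
next
  case False
  \<comment> \<open>The bound uses the law of \<open>W\<close> and the deviation probability of
    \<open>s\<close> separately, so \<open>W\<close> may change sign while \<open>s\<close> is
    kept.\<close>
  have "distributed M lborel (\<lambda>\<omega>. - W \<omega>) std_normal_density"
    using normal_density_affine[OF W, of "-1" 0] by simp
  from prob_hit_lower_nonneg[OF this s p d T a, of "- v"] False show ?thesis
    by (simp add: hit_uminus)
qed

text \<open>At this nearly least favourable \<open>v\<close>, a hit with \<open>s\<close> near 1
  confines \<open>W\<close> to an interval slightly longer than the one behind
  \<open>limit_cover\<close>. The summand \<open>\<delta>\<close> in \<open>v\<close> moves its left
  end by one more \<open>\<delta>\<close>, whence the 3.\<close>

lemma prob_hit_upper: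
  assumes W: "distributed M lborel W std_normal_density"
    and s[measurable]: "s \<in> borel_measurable M"
    and p: "prob {\<omega> \<in> space M. \<bar>s \<omega> - 1\<bar> > \<delta>} \<le> p"
    and d: "0 < \<delta>" "\<delta> \<le> 1 / 2" and T: "0 < T" and a: "0 \<le> \<alpha>"
  shows "prob {\<omega> \<in> space M. hit T \<alpha> ((1 + \<delta>) * \<alpha> + \<delta>) (s \<omega>) (W \<omega>)}
    \<le> limit_cover T \<alpha> + (p + \<delta> * (3 + 2 * T))"
proof -
  have [measurable]: "W \<in> borel_measurable M" using distributed_measurable[OF W] by simp
  let ?x = "(1 - \<delta>) * T - ((1 + \<delta>) * \<alpha> + \<delta>)"
  let ?I = "{\<omega> \<in> space M. ?x < W \<omega> \<and> W \<omega> \<le> (1 + \<delta>) * \<alpha>}"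
  let ?B = "{\<omega> \<in> space M. \<bar>s \<omega> - 1\<bar> > \<delta>}"
  let ?H = "{\<omega> \<in> space M. hit T \<alpha> ((1 + \<delta>) * \<alpha> + \<delta>) (s \<omega>) (W \<omega>)}"
  have "?H \<subseteq> ?I \<union> ?B"
  proof
    fix \<omega> assume \<omega>: "\<omega> \<in> ?H"
    show "\<omega> \<in> ?I \<union> ?B"
    proof (cases "\<bar>s \<omega> - 1\<bar> > \<delta>")
      case False
      then have "1 - \<delta> \<le> s \<omega>" "s \<omega> \<le> 1 + \<delta>" by auto
      from hit_far[OF this d T a, of "W \<omega>"] \<omega> show ?thesis by simp
    qed (use \<omega> in auto)
  qed
  then have "prob ?H \<le> prob (?I \<union> ?B)" by (intro finite_measure_mono) auto
  also have "\<dots> \<le> prob ?I + prob ?B" by (intro measure_Un_le) auto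
  finally have "prob ?H \<le> prob ?I + p" using p by linarith
  moreover have "prob ?I = max 0 (cdf std_normal_distribution ((1 + \<delta>) * \<alpha>) - cdf std_normal_distribution ?x)"
    by (rule std_normal_prob_interval[OF W])
  moreover have "\<bar>cdf std_normal_distribution ((1 + \<delta>) * \<alpha>) - cdf std_normal_distribution \<alpha>\<bar> \<le> \<delta>"
    using cdf_std_normal_scale[of "1 + \<delta>" \<alpha>] d by simp
  moreover have "\<bar>cdf std_normal_distribution ((1 + \<delta>) * (T - \<alpha>)) - cdf std_normal_distribution (T - \<alpha>)\<bar> \<le> \<delta>"
    using cdf_std_normal_scale[of "1 + \<delta>" "T - \<alpha>"] d by simp
  moreover have "cdf std_normal_distribution ((1 + \<delta>) * (T - \<alpha>)) \<le> cdf std_normal_distribution ?x + (2 * \<delta> * T + \<delta>)"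
    using cdf_std_normal_lipschitz[of ?x "(1 + \<delta>) * (T - \<alpha>)"] d T
    by (simp add: algebra_simps)
  moreover have "0 \<le> p" using p measure_nonneg[of M ?B] by linarith
  moreover have "0 \<le> \<delta> * T" using d T by simp
  ultimately show ?thesis using d unfolding limit_cover_def by (simp add: algebra_simps)
qed

end

subsection \<open>Linear and quadratic forms in Gaussian vectors\<close>

locale gaussian_vector =
  fixes I :: "nat set" and \<mu> :: "nat \<Rightarrow> real" and \<sigma> :: real
  assumes fin: "finite I" and \<sigma>_pos: "0 < \<sigma>"
begin

definition G :: "(nat \<Rightarrow> real) measure" where
  "G = PiM I (\<lambda>j. density lborel (normal_density (\<mu> j) \<sigma>))"

lemma sets_G [measurable_cong]: "sets G = sets (PiM I (\<lambda>_. borel))"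
  unfolding G_def by (intro sets_PiM_cong) auto

lemma prob_space_G: "prob_space G"
  unfolding G_def using \<sigma>_pos by (intro prob_space_PiM prob_space_normal_density)

sublocale prob_space G by (rule prob_space_G)

lemma coordinate_normal:
  assumes "j \<in> I" shows "distributed G lborel (\<lambda>y. y j) (normal_density (\<mu> j) \<sigma>)"
proof -
  have "distr G (density lborel (normal_density (\<mu> j) \<sigma>)) (\<lambda>y. y j) = density lborel (normal_density (\<mu> j) \<sigma>)"
    unfolding G_def using assms \<sigma>_pos fin
    by (intro distr_PiM_component prob_space_normal_density)
  moreover have "distr G (density lborel (normal_density (\<mu> j) \<sigma>)) (\<lambda>y. y j) = distr G lborel (\<lambda>y. y j)"
    by (intro distr_cong) auto
  ultimately show ?thesis using assms
    unfolding distributed_def by auto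
qed

lemma coordinates_indep:
  assumes "I \<noteq> {}" shows "indep_vars (\<lambda>_. borel) (\<lambda>j y. y j) I"
proof -
  have rv: "random_variable borel (\<lambda>y. y j)" if "j \<in> I" for j
    using that by measurable
  \<comment> \<open>Points of \<open>space G\<close> are extensional on \<open>I\<close>, so the
    restriction is the identity and the joint law is \<open>G\<close> itself.\<close>
  have "distr G (PiM I (\<lambda>_. borel)) (\<lambda>y. \<lambda>j\<in>I. y j) = distr G G (\<lambda>y. y)"
    by (intro distr_cong sets_G[symmetric]) (auto simp: G_def space_PiM PiE_restrict)
  also have "\<dots> = PiM I (\<lambda>j. distr G borel (\<lambda>y. y j))"
  proof -
    have "distr G borel (\<lambda>y. y j) = density lborel (normal_density (\<mu> j) \<sigma>)" if "j \<in> I" for j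
      using distributed_distr_eq_density[OF coordinate_normal[OF that]]
      by (simp cong: distr_cong)
    then show ?thesis by (simp add: G_def cong: PiM_cong)
  qed
  finally show ?thesis
    using indep_vars_iff_distr_eq_PiM'[OF assms rv] by simp
qed

lemma linear_normal:
  assumes "0 < (\<Sum>j\<in>I. (w j)\<^sup>2)"
  shows "distributed G lborel (\<lambda>y. \<Sum>j\<in>I. w j * y j)
    (normal_density (\<Sum>j\<in>I. w j * \<mu> j) (\<sigma> * sqrt (\<Sum>j\<in>I. (w j)\<^sup>2)))"
proof -
  \<comment> \<open>Terms of weight zero are constants without a normal density and are dropped
    before summing independent normals.\<close>
  define J where "J = {j \<in> I. w j \<noteq> 0}"
  have J: "J \<subseteq> I" "finite J" using fin by (auto simp: J_def)
  have sumJ: "(\<Sum>j\<in>I. f j) = (\<Sum>j\<in>J. f j)" if "\<And>j. w j = 0 \<Longrightarrow> f j = 0" for f :: "nat \<Rightarrow> real"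
    using that by (intro sum.mono_neutral_right) (auto simp: J_def fin)
  have "J \<noteq> {}" using assms by (subst (asm) sumJ) auto
  then have "I \<noteq> {}" using J by auto
  have "indep_vars (\<lambda>_. borel) (\<lambda>j y. w j * y j) J"
    by (rule indep_vars_compose2[OF indep_vars_subset[OF coordinates_indep[OF \<open>I \<noteq> {}\<close>] J(1)]]) simp
  moreover have "distributed G lborel (\<lambda>y. w j * y j) (normal_density (w j * \<mu> j) (\<bar>w j\<bar> * \<sigma>))" if "j \<in> J" for j
    using normal_density_affine[OF coordinate_normal[of j] \<sigma>_pos, of "w j" 0] that J by (auto simp: J_def)
  ultimately have "distributed G lborel (\<lambda>y. \<Sum>j\<in>J. w j * y j)
    (normal_density (\<Sum>j\<in>J. w j * \<mu> j) (sqrt (\<Sum>j\<in>J. (\<bar>w j\<bar> * \<sigma>)\<^sup>2)))"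
    using \<sigma>_pos by (intro sum_indep_normal J \<open>J \<noteq> {}\<close>) (auto simp: J_def)
  moreover have "sqrt (\<Sum>j\<in>J. (\<bar>w j\<bar> * \<sigma>)\<^sup>2) = \<sigma> * sqrt (\<Sum>j\<in>I. (w j)\<^sup>2)"
    using \<sigma>_pos by (subst sumJ) (auto simp: power_mult_distrib sum_distrib_right[symmetric] real_sqrt_mult)
  ultimately show ?thesis by (simp add: sumJ)
qed

text \<open>A nondegenerate form is normal with known even central moments; one with zero weights
  vanishes. Both cases matter, since rows of a projection and differences of weights may be
  zero.\<close>

lemma centered_fourth_moment:
  "integrable G (\<lambda>y. (\<Sum>j\<in>I. w j * (y j - \<mu> j)) ^ 4)"
  "expectation (\<lambda>y. (\<Sum>j\<in>I. w j * (y j - \<mu> j)) ^ 4) = 3 * \<sigma> ^ 4 * (\<Sum>j\<in>I. (w j)\<^sup>2)\<^sup>2"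
  "integrable G (\<lambda>y. (\<Sum>j\<in>I. w j * (y j - \<mu> j))\<^sup>2)"
  "expectation (\<lambda>y. (\<Sum>j\<in>I. w j * (y j - \<mu> j))\<^sup>2) = \<sigma>\<^sup>2 * (\<Sum>j\<in>I. (w j)\<^sup>2)"
proof -
  have *: "integrable G (\<lambda>y. (\<Sum>j\<in>I. w j * (y j - \<mu> j)) ^ (2 * k)) \<and>
    expectation (\<lambda>y. (\<Sum>j\<in>I. w j * (y j - \<mu> j)) ^ (2 * k))
      = fact (2 * k) / (2 ^ k * fact k) * (\<sigma>\<^sup>2 * (\<Sum>j\<in>I. (w j)\<^sup>2)) ^ k" if "k > 0" for k
  proof (cases "(\<Sum>j\<in>I. (w j)\<^sup>2) = 0")
    case True
    then have "\<And>j. j \<in> I \<Longrightarrow> w j = 0" using fin by (subst (asm) sum_nonneg_eq_0_iff) auto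
    then have "(\<Sum>j\<in>I. w j * (y j - \<mu> j)) = 0" for y by (intro sum.neutral) auto
    then show ?thesis using True that by (simp add: zero_power)
  next
    case False
    moreover have "0 \<le> (\<Sum>j\<in>I. (w j)\<^sup>2)" by (intro sum_nonneg) auto
    ultimately have pos: "0 < (\<Sum>j\<in>I. (w j)\<^sup>2)" by linarith
    let ?m = "\<Sum>j\<in>I. w j * \<mu> j" and ?s = "\<sigma> * sqrt (\<Sum>j\<in>I. (w j)\<^sup>2)"
    have eq: "(\<Sum>j\<in>I. w j * (y j - \<mu> j)) = (\<Sum>j\<in>I. w j * y j) - ?m" for y
      by (simp add: algebra_simps sum_subtractf)
    have D: "distributed G lborel (\<lambda>y. \<Sum>j\<in>I. w j * y j) (normal_density ?m ?s)"
      by (rule linear_normal[OF pos])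
    have "0 < ?s" using pos \<sigma>_pos by simp
    have "integrable G (\<lambda>y. ((\<Sum>j\<in>I. w j * y j) - ?m) ^ (2 * k))"
      using distributed_integrable[OF D, of "\<lambda>x. (x - ?m) ^ (2 * k)"] integrable_normal_moment[OF \<open>0 < ?s\<close>] by simp
    moreover have "expectation (\<lambda>y. ((\<Sum>j\<in>I. w j * y j) - ?m) ^ (2 * k)) = fact (2 * k) / ((2 / ?s\<^sup>2) ^ k * fact k)"
      using distributed_integral[OF D, of "\<lambda>x. (x - ?m) ^ (2 * k)"] integral_normal_moment_even[OF \<open>0 < ?s\<close>] by simp
    moreover have "?s\<^sup>2 = \<sigma>\<^sup>2 * (\<Sum>j\<in>I. (w j)\<^sup>2)" using pos by (simp add: power_mult_distrib)
    ultimately show ?thesis unfolding eq by (simp add: power_divide)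
  qed
  show "integrable G (\<lambda>y. (\<Sum>j\<in>I. w j * (y j - \<mu> j)) ^ 4)"
    "expectation (\<lambda>y. (\<Sum>j\<in>I. w j * (y j - \<mu> j)) ^ 4) = 3 * \<sigma> ^ 4 * (\<Sum>j\<in>I. (w j)\<^sup>2)\<^sup>2"
    using *[of 2] by (simp_all add: fact_numeral power_mult_distrib flip: power_mult)
  show "integrable G (\<lambda>y. (\<Sum>j\<in>I. w j * (y j - \<mu> j))\<^sup>2)"
    "expectation (\<lambda>y. (\<Sum>j\<in>I. w j * (y j - \<mu> j))\<^sup>2) = \<sigma>\<^sup>2 * (\<Sum>j\<in>I. (w j)\<^sup>2)"
    using *[of 1] by simp_all
qed

text \<open>Isserlis' formula for two Gaussian linear forms, each taken twice.\<close>

lemma centered_mixed_moment: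
  fixes a b :: "nat \<Rightarrow> real"
  defines "A \<equiv> \<lambda>y. \<Sum>j\<in>I. a j * (y j - \<mu> j)" and "B \<equiv> \<lambda>y. \<Sum>j\<in>I. b j * (y j - \<mu> j)"
  shows "integrable G (\<lambda>y. (A y)\<^sup>2 * (B y)\<^sup>2)"
    and "expectation (\<lambda>y. (A y)\<^sup>2 * (B y)\<^sup>2)
      = \<sigma> ^ 4 * ((\<Sum>j\<in>I. (a j)\<^sup>2) * (\<Sum>j\<in>I. (b j)\<^sup>2) + 2 * (\<Sum>j\<in>I. a j * b j)\<^sup>2)"
proof -
  let ?P = "\<lambda>y. \<Sum>j\<in>I. (a j + b j) * (y j - \<mu> j)" and ?D = "\<lambda>y. \<Sum>j\<in>I. (a j - b j) * (y j - \<mu> j)"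
  have PD: "?P y = A y + B y" "?D y = A y - B y" for y
    by (simp_all add: A_def B_def algebra_simps sum.distrib sum_subtractf)
  \<comment> \<open>Polarization reduces the mixed moment to fourth moments of single linear forms,
    so no fourth-order products of coordinates have to be integrated.\<close>
  have polar: "(A y)\<^sup>2 * (B y)\<^sup>2 = ((?P y) ^ 4 + (?D y) ^ 4 - 2 * (A y) ^ 4 - 2 * (B y) ^ 4) / 12" for y
    unfolding PD by (simp add: field_simps power4_eq_xxxx power2_eq_square)
  have int: "integrable G (\<lambda>y. ?P y ^ 4)" "integrable G (\<lambda>y. ?D y ^ 4)" "integrable G (\<lambda>y. A y ^ 4)" "integrable G (\<lambda>y. B y ^ 4)"
    unfolding A_def B_def by (rule centered_fourth_moment)+
  show "integrable G (\<lambda>y. (A y)\<^sup>2 * (B y)\<^sup>2)"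
    unfolding polar using int by simp
  have "expectation (\<lambda>y. (A y)\<^sup>2 * (B y)\<^sup>2)
    = (expectation (\<lambda>y. ?P y ^ 4) + expectation (\<lambda>y. ?D y ^ 4) - 2 * expectation (\<lambda>y. A y ^ 4) - 2 * expectation (\<lambda>y. B y ^ 4)) / 12"
    unfolding polar using int by simp
  also have "\<dots> = \<sigma> ^ 4 * ((\<Sum>j\<in>I. (a j + b j)\<^sup>2)\<^sup>2 + (\<Sum>j\<in>I. (a j - b j)\<^sup>2)\<^sup>2
      - 2 * (\<Sum>j\<in>I. (a j)\<^sup>2)\<^sup>2 - 2 * (\<Sum>j\<in>I. (b j)\<^sup>2)\<^sup>2) / 4"
    unfolding A_def B_def centered_fourth_moment by (simp add: field_simps)
  also have "(\<Sum>j\<in>I. (a j + b j)\<^sup>2) = (\<Sum>j\<in>I. (a j)\<^sup>2) + 2 * (\<Sum>j\<in>I. a j * b j) + (\<Sum>j\<in>I. (b j)\<^sup>2)"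
    by (simp add: power2_sum sum.distrib sum_distrib_left algebra_simps)
  also have "(\<Sum>j\<in>I. (a j - b j)\<^sup>2) = (\<Sum>j\<in>I. (a j)\<^sup>2) - 2 * (\<Sum>j\<in>I. a j * b j) + (\<Sum>j\<in>I. (b j)\<^sup>2)"
    by (simp add: power2_diff sum.distrib sum_subtractf sum_distrib_left algebra_simps)
  finally show "expectation (\<lambda>y. (A y)\<^sup>2 * (B y)\<^sup>2)
      = \<sigma> ^ 4 * ((\<Sum>j\<in>I. (a j)\<^sup>2) * (\<Sum>j\<in>I. (b j)\<^sup>2) + 2 * (\<Sum>j\<in>I. a j * b j)\<^sup>2)"
    by (simp add: algebra_simps power2_eq_square)
qed

text \<open>The first two assumptions hold for an orthogonal projection of rank \<open>m\<close>; the mixed moments then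
  give the chi-square variance \<open>2 * m\<close> without diagonalizing the projection.\<close>
lemma projection_concentration:
  fixes P :: "nat \<Rightarrow> nat \<Rightarrow> real" and m :: real
  assumes gram: "\<And>r q. r \<in> I \<Longrightarrow> q \<in> I \<Longrightarrow> (\<Sum>j\<in>I. P r j * P q j) = P r q"
    and trace: "(\<Sum>r\<in>I. P r r) = m" and m: "0 < m" and "0 < \<delta>"
  shows "prob {y \<in> space G. \<bar>sqrt ((\<Sum>r\<in>I. (\<Sum>j\<in>I. P r j * (y j - \<mu> j))\<^sup>2) / m) / \<sigma> - 1\<bar> > \<delta>}
    \<le> 2 / (m * \<delta>\<^sup>2)"
proof -
  let ?L = "\<lambda>r y. \<Sum>j\<in>I. P r j * (y j - \<mu> j)"
  define Q where "Q y = (\<Sum>r\<in>I. (?L r y)\<^sup>2)" for y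
  have [measurable]: "Q \<in> borel_measurable G" unfolding Q_def by measurable
  have norm: "(\<Sum>j\<in>I. (P r j)\<^sup>2) = P r r" if "r \<in> I" for r
    using gram[OF that that] by (simp add: power2_eq_square)
  have EQ: "expectation Q = \<sigma>\<^sup>2 * m" "integrable G Q"
    unfolding Q_def using trace
    by (simp_all add: centered_fourth_moment norm sum_distrib_left[symmetric])
  have Q2: "(Q y)\<^sup>2 = (\<Sum>r\<in>I. \<Sum>q\<in>I. (?L r y)\<^sup>2 * (?L q y)\<^sup>2)" for y
    by (simp add: Q_def power2_eq_square sum_product)
  have intQ2: "integrable G (\<lambda>y. (Q y)\<^sup>2)"
    unfolding Q2 by (intro Bochner_Integration.integrable_sum centered_mixed_moment)
  have "expectation (\<lambda>y. (Q y)\<^sup>2) = (\<Sum>r\<in>I. \<Sum>q\<in>I. \<sigma> ^ 4 * (P r r * P q q + 2 * (P r q)\<^sup>2))"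
    unfolding Q2 by (simp add: centered_mixed_moment norm gram)
  also have "\<dots> = \<sigma> ^ 4 * ((\<Sum>r\<in>I. P r r) * (\<Sum>q\<in>I. P q q) + 2 * (\<Sum>r\<in>I. \<Sum>q\<in>I. (P r q)\<^sup>2))"
    by (simp add: sum_distrib_left[symmetric] sum.distrib sum_product)
  \<comment> \<open>By \<open>gram\<close> the squares in row \<open>r\<close> sum to
    \<open>P r r\<close>, so the total is the trace.\<close>
  also have "(\<Sum>r\<in>I. \<Sum>q\<in>I. (P r q)\<^sup>2) = m" using trace by (simp add: norm)
  finally have "expectation (\<lambda>y. (Q y)\<^sup>2) = \<sigma> ^ 4 * (m\<^sup>2 + 2 * m)"
    by (simp add: trace power2_eq_square)
  then have var: "variance Q = 2 * \<sigma> ^ 4 * m"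
    using EQ intQ2 by (subst variance_eq) (auto simp: algebra_simps power_mult_distrib simp flip: power_mult)
  have "prob {y \<in> space G. \<bar>sqrt (Q y / m) / \<sigma> - 1\<bar> > \<delta>} \<le> prob {y \<in> space G. \<delta> * (\<sigma>\<^sup>2 * m) \<le> \<bar>Q y - expectation Q\<bar>}"
  proof (intro finite_measure_mono subsetI)
    fix y assume "y \<in> {y \<in> space G. \<bar>sqrt (Q y / m) / \<sigma> - 1\<bar> > \<delta>}"
    then have y: "y \<in> space G" and *: "\<delta> < \<bar>sqrt (Q y / m) / \<sigma> - 1\<bar>" by auto
    let ?s = "sqrt (Q y / m) / \<sigma>"
    have "0 \<le> Q y" unfolding Q_def by (intro sum_nonneg) auto
    then have s: "0 \<le> ?s" and sq: "?s\<^sup>2 = Q y / (\<sigma>\<^sup>2 * m)"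
      using m \<sigma>_pos by (auto simp: power_divide)
    \<comment> \<open>As \<open>?s + 1 \<ge> 1\<close>, the root deviates from 1 by no more than its
      square does, so it suffices to control \<open>Q\<close>.\<close>
    have "\<bar>?s - 1\<bar> * 1 \<le> \<bar>?s - 1\<bar> * (?s + 1)" using s by (intro mult_left_mono) auto
    also have "\<dots> = \<bar>(?s - 1) * (?s + 1)\<bar>" using s by (simp add: abs_mult)
    also have "(?s - 1) * (?s + 1) = ?s\<^sup>2 - 1" by (simp add: algebra_simps power2_eq_square)
    also have "\<dots> = (Q y - expectation Q) / (\<sigma>\<^sup>2 * m)" using m \<sigma>_pos unfolding sq EQ by (simp add: field_simps)
    finally have "\<delta> \<le> \<bar>Q y - expectation Q\<bar> / (\<sigma>\<^sup>2 * m)" using * m \<sigma>_pos by (simp add: abs_divide abs_mult)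
    then show "y \<in> {y \<in> space G. \<delta> * (\<sigma>\<^sup>2 * m) \<le> \<bar>Q y - expectation Q\<bar>}"
      using m \<sigma>_pos y by (simp add: le_divide_eq)
  qed measurable
  also have "\<dots> \<le> variance Q / (\<delta> * (\<sigma>\<^sup>2 * m))\<^sup>2"
    using m \<sigma>_pos \<open>0 < \<delta>\<close> intQ2 by (intro Chebyshev_inequality) auto
  also have "\<dots> = 2 / (m * \<delta>\<^sup>2)"
    using m \<sigma>_pos \<open>0 < \<delta>\<close> unfolding var by (simp add: field_simps power2_eq_square power4_eq_xxxx)
  finally show ?thesis unfolding Q_def .
qed

end

subsection \<open>Least squares\<close>

text \<open>Independence is a property of the set of columns, which hides repetitions. A repeated
  column would leave fewer than \<open>nc\<close> elements for a maximal independent subset, whose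
  size is the rank.\<close>

lemma (in vec_space) full_rank_distinct_cols:
  assumes A: "A \<in> carrier_mat n nc" and r: "rank A = nc"
  shows "distinct (cols A)"
proof (rule ccontr)
  assume "\<not> distinct (cols A)"
  obtain S where S: "maximal S (\<lambda>T. T \<subseteq> set (cols A) \<and> lin_indpt T)"
    using maximal_exists[of "(\<lambda>T. T \<subseteq> set (cols A) \<and> lin_indpt T)" "card (set (cols A))" "{}"]
    by (meson List.finite_set card_mono empty_iff empty_subsetI finite_lin_indpt2 rev_finite_subset)
  then have "card S \<le> card (set (cols A))" by (simp add: card_mono maximal_def)
  also have "\<dots> < nc"
    using \<open>\<not> distinct (cols A)\<close> A card_distinct[of "cols A"] card_length[of "cols A"]
    by (auto simp: le_less)
  finally show False using rank_card_indpt[OF A S] r by simp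
qed

lemma full_rank_mult_vec_eq_0:
  fixes A :: "real mat"
  assumes A: "A \<in> carrier_mat n k" and r: "vec_space.rank n A = k"
    and v: "v \<in> carrier_vec k" "A *\<^sub>v v = 0\<^sub>v n"
  shows "v = 0\<^sub>v k"
proof (rule ccontr)
  interpret vec_space "TYPE(real)" n .
  assume "v \<noteq> 0\<^sub>v k"
  have d: "distinct (cols A)" by (rule full_rank_distinct_cols[OF A r])
  then show False
    using lin_depI[OF A v(1) \<open>v \<noteq> 0\<^sub>v k\<close> v(2) d] full_rank_lin_indpt[OF A r d] by blast
qed

lemma scalar_prod_sum: "v \<bullet> vec n f = (\<Sum>j<n. v $ j * f j)"
  by (simp add: scalar_prod_def lessThan_atLeast0)

text \<open>If the Gram matrix kills \<open>v\<close>, then \<open>A *\<^sub>v v\<close> has squared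
  length 0, and full rank gives \<open>v = 0\<close>. Hence the inverse selected by
  \<open>the\<close> exists.\<close>

lemma XtX_inv_inverse:
  assumes A: "A \<in> carrier_mat n k" and r: "vec_space.rank n A = k"
  shows "XtX_inv A \<in> carrier_mat k k" "A\<^sup>T * A * XtX_inv A = 1\<^sub>m k" "XtX_inv A * (A\<^sup>T * A) = 1\<^sub>m k"
proof -
  let ?G = "A\<^sup>T * A"
  have G: "?G \<in> carrier_mat k k" using A by simp
  have "det ?G \<noteq> 0"
  proof
    assume "det ?G = 0"
    then obtain v where v: "v \<in> carrier_vec k" "v \<noteq> 0\<^sub>v k" "?G *\<^sub>v v = 0\<^sub>v k"
      using det_0_iff_vec_prod_zero_field[OF G] by auto
    have Av: "A *\<^sub>v v \<in> carrier_vec n" using A v by simp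
    have "(A *\<^sub>v v) \<bullet> (A *\<^sub>v v) = v \<bullet> (A\<^sup>T *\<^sub>v (A *\<^sub>v v))"
      using transpose_vec_mult_scalar[OF A v(1) Av] comm_scalar_prod[OF v(1), of "A\<^sup>T *\<^sub>v (A *\<^sub>v v)"]
        mult_mat_vec_carrier[OF transpose_carrier_mat[THEN iffD2, OF A] Av] by simp
    also have "A\<^sup>T *\<^sub>v (A *\<^sub>v v) = 0\<^sub>v k" using v A assoc_mult_mat_vec[of "A\<^sup>T" k n A k v] by simp
    finally have "(A *\<^sub>v v) \<bullet> (A *\<^sub>v v) = 0" using v by simp
    then have "A *\<^sub>v v = 0\<^sub>v n"
      using conjugate_square_eq_0_vec[OF Av] by (simp add: conjugate_vec_def)
    then show False using full_rank_mult_vec_eq_0[OF A r v(1)] v(2) by simp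
  qed
  then have "?G \<in> Units (ring_mat TYPE(real) k ())" by (rule det_non_zero_imp_unit[OF G])
  then obtain B where "mat_inverse ?G = Some B"
    using mat_inverse(1)[OF G, where b = "()"] by (cases "mat_inverse ?G") auto
  then show "XtX_inv A \<in> carrier_mat k k" "?G * XtX_inv A = 1\<^sub>m k" "XtX_inv A * ?G = 1\<^sub>m k"
    using mat_inverse(2)[OF G] unfolding XtX_inv_def by auto
qed

text \<open>Translates the matrix algebra into finite sums: \<open>b\<close> is row \<open>i\<close>
  of \<open>XtX_inv A * A\<^sup>T\<close>, and \<open>P\<close> holds the entries of the projection
  onto the residual space.\<close>

lemma least_squares_coefficients:
  assumes A: "A \<in> carrier_mat n k" and r: "vec_space.rank n A = k" and i: "i < k" and n: "0 < n"
  obtains b :: "nat \<Rightarrow> real" and P :: "nat \<Rightarrow> nat \<Rightarrow> real" where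
    "\<And>y. theta_LS A (vec n y) $ i = (\<Sum>j<n. b j * y j)"
    "\<And>y. sigma_hat A (vec n y) = sqrt ((\<Sum>r<n. (\<Sum>j<n. P r j * y j)\<^sup>2) / (real n - real k))"
    "\<And>\<theta>. \<theta> \<in> carrier_vec k \<Longrightarrow> (\<Sum>j<n. b j * (A *\<^sub>v \<theta>) $ j) = \<theta> $ i"
    "\<And>\<theta> r. \<theta> \<in> carrier_vec k \<Longrightarrow> r < n \<Longrightarrow> (\<Sum>j<n. P r j * (A *\<^sub>v \<theta>) $ j) = 0"
    "xi A i = sqrt (real n * (\<Sum>j<n. (b j)\<^sup>2))" "0 < (\<Sum>j<n. (b j)\<^sup>2)"
    "\<And>r q. r < n \<Longrightarrow> q < n \<Longrightarrow> (\<Sum>j<n. P r j * P q j) = P r q"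
    "(\<Sum>r<n. P r r) = real n - real k"
proof -
  define N where "N = XtX_inv A"
  have N: "N \<in> carrier_mat k k" and GN: "A\<^sup>T * A * N = 1\<^sub>m k" and NG: "N * (A\<^sup>T * A) = 1\<^sub>m k"
    unfolding N_def by (rule XtX_inv_inverse[OF A r])+
  have At: "A\<^sup>T \<in> carrier_mat k n" and G: "A\<^sup>T * A \<in> carrier_mat k k" and Nt: "N\<^sup>T \<in> carrier_mat k k"
    using A N by auto
  have Gsym: "(A\<^sup>T * A)\<^sup>T = A\<^sup>T * A" using A by (simp add: transpose_mult[OF At A])
  have "N\<^sup>T * (A\<^sup>T * A) = 1\<^sub>m k"
    using arg_cong[OF GN, of transpose_mat] transpose_mult[OF G N] Gsym by simp
  then have Nsym: "N\<^sup>T = N"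
    using assoc_mult_mat[OF Nt G N] GN N Nt by simp
  define C where "C = N * A\<^sup>T"
  have C: "C \<in> carrier_mat k n" using N At by (simp add: C_def)
  have CA: "C * A = 1\<^sub>m k" using NG assoc_mult_mat[OF N At A] by (simp add: C_def)
  have Ct: "C\<^sup>T = A * N" using transpose_mult[OF N At] Nsym by (simp add: C_def)
  \<comment> \<open>Its diagonal identifies the squared norm of row \<open>i\<close> of
    \<open>C\<close> with the entry of \<open>N\<close> that determines \<open>xi\<close>.\<close>
  have CCt: "C * C\<^sup>T = N"
  proof -
    have "C * C\<^sup>T = C * A * N" unfolding Ct using assoc_mult_mat[OF C A N] by simp
    then show ?thesis using CA N by simp
  qed
  define P where "P = 1\<^sub>m n - A * C"
  have H: "A * C \<in> carrier_mat n n" and P: "P \<in> carrier_mat n n" using A C by (auto simp: P_def)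
  have PA: "P * A = 0\<^sub>m n k"
  proof -
    have "P * A = 1\<^sub>m n * A - A * C * A" unfolding P_def by (rule minus_mult_distrib_mat) (use A H in auto)
    also have "A * C * A = A * (C * A)" by (rule assoc_mult_mat[OF A C A])
    finally show ?thesis using CA A by simp
  qed
  have "(A * C)\<^sup>T = A * C"
    using transpose_mult[OF A C] Ct A N At by (simp add: C_def assoc_mult_mat[OF A N At])
  then have Psym: "P\<^sup>T = P" unfolding P_def using H by (simp add: transpose_minus[of _ n n])
  have PP: "P * P\<^sup>T = P"
  proof -
    have "P * P = P * 1\<^sub>m n - P * (A * C)"
      by (subst (2) P_def) (rule mult_minus_distrib_mat[OF P _ H], simp)
    also have "P * (A * C) = 0\<^sub>m n n" using PA assoc_mult_mat[OF P A C] C by simp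
    also have "P * 1\<^sub>m n - 0\<^sub>m n n = P" using P by (intro eq_matI) auto
    finally show ?thesis using Psym by simp
  qed
  show thesis
  proof (rule that[of "\<lambda>j. C $$ (i, j)" "\<lambda>r j. P $$ (r, j)"])
    have LS: "theta_LS A (vec n y) = C *\<^sub>v vec n y" for y
      unfolding theta_LS_def N_def[symmetric] C_def using assoc_mult_mat_vec[OF N At] by simp
    show "theta_LS A (vec n y) $ i = (\<Sum>j<n. C $$ (i, j) * y j)" for y
      using C i by (simp add: LS scalar_prod_sum)
    show "sigma_hat A (vec n y) = sqrt ((\<Sum>r<n. (\<Sum>j<n. P $$ (r, j) * y j)\<^sup>2) / (real n - real k))" for y
    proof -
      have "vec n y - A *\<^sub>v theta_LS A (vec n y) = P *\<^sub>v vec n y"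
        using minus_mult_distrib_mat_vec[of "1\<^sub>m n" n n "A * C" "vec n y"] H assoc_mult_mat_vec[OF A C]
        by (simp add: LS P_def)
      also have "\<dots> = vec n (\<lambda>r. \<Sum>j<n. P $$ (r, j) * y j)"
        using P by (intro eq_vecI) (auto simp: scalar_prod_sum)
      finally show ?thesis using A
        by (simp add: sigma_hat_def scalar_prod_sum power2_eq_square)
    qed
    have sum_mult: "(\<Sum>j<n. M $$ (r, j) * v $ j) = (M *\<^sub>v v) $ r"
      if "M \<in> carrier_mat l n" "r < l" "v \<in> carrier_vec n" for M :: "real mat" and v r l
      using that by (simp add: scalar_prod_def lessThan_atLeast0)
    show "(\<Sum>j<n. C $$ (i, j) * (A *\<^sub>v \<theta>) $ j) = \<theta> $ i" if "\<theta> \<in> carrier_vec k" for \<theta>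
      using sum_mult[OF C i, of "A *\<^sub>v \<theta>"] assoc_mult_mat_vec[OF C A that] CA A that by simp
    show "(\<Sum>j<n. P $$ (r, j) * (A *\<^sub>v \<theta>) $ j) = 0" if "\<theta> \<in> carrier_vec k" "r < n" for \<theta> r
    proof -
      have "P *\<^sub>v (A *\<^sub>v \<theta>) = 0\<^sub>m n k *\<^sub>v \<theta>" using assoc_mult_mat_vec[OF P A that(1)] PA by simp
      then show ?thesis
        using sum_mult[OF P that(2) mult_mat_vec_carrier[OF A that(1)]] that by (simp add: scalar_prod_def)
    qed
    have sum_gram: "(\<Sum>j<n. M $$ (r, j) * M $$ (q, j)) = (M * M\<^sup>T) $$ (r, q)"
      if "M \<in> carrier_mat l n" "r < l" "q < l" for M :: "real mat" and r q l
      using that by (simp add: scalar_prod_def lessThan_atLeast0)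
    show "(\<Sum>j<n. P $$ (r, j) * P $$ (q, j)) = P $$ (r, q)" if "r < n" "q < n" for r q
      using sum_gram[OF P that] PP by simp
    have Nii: "(\<Sum>j<n. (C $$ (i, j))\<^sup>2) = N $$ (i, i)"
      using sum_gram[OF C i i] CCt by (simp add: power2_eq_square)
    show "0 < (\<Sum>j<n. (C $$ (i, j))\<^sup>2)"
    proof (rule ccontr)
      assume "\<not> 0 < (\<Sum>j<n. (C $$ (i, j))\<^sup>2)"
      then have "(\<Sum>j<n. (C $$ (i, j))\<^sup>2) = 0" by (meson sum_nonneg zero_le_power2 not_less order_antisym)
      then have "\<And>j. j < n \<Longrightarrow> C $$ (i, j) = 0" by (subst (asm) sum_nonneg_eq_0_iff) auto
      then have "(C * A) $$ (i, i) = 0" using C A i by (simp add: scalar_prod_def)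
      then show False using CA i by simp
    qed
    show "xi A i = sqrt (real n * (\<Sum>j<n. (C $$ (i, j))\<^sup>2))"
    proof -
      \<comment> \<open>\<open>mat_inverse\<close> yields some inverse \<open>B\<close> of the
        scaled Gram matrix; uniqueness of inverses identifies it with \<open>n\<close> times
        \<open>N\<close>.\<close>
      let ?S = "(1 / real n) \<cdot>\<^sub>m (A\<^sup>T * A)"
      have S: "?S \<in> carrier_mat k k" using G by simp
      have SN: "?S * (real n \<cdot>\<^sub>m N) = 1\<^sub>m k"
        using mult_smult_assoc_mat[OF G, of "real n \<cdot>\<^sub>m N" k "1 / real n"] mult_smult_distrib[OF G N] GN N n
        by (intro eq_matI) auto
      have NS: "(real n \<cdot>\<^sub>m N) * ?S = 1\<^sub>m k"
        using SN mat_mult_left_right_inverse[OF S _ SN] N by simp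
      have "?S \<in> Units (ring_mat TYPE(real) k ())"
        unfolding Units_def ring_mat_def using S N SN NS by auto
      then obtain B where B: "mat_inverse ?S = Some B"
        using mat_inverse(1)[OF S, where b = "()"] by (cases "mat_inverse ?S") auto
      then have BS: "B * ?S = 1\<^sub>m k" and Bc: "B \<in> carrier_mat k k" using mat_inverse(2)[OF S] by auto
      have "B = B * (?S * (real n \<cdot>\<^sub>m N))" using SN Bc by simp
      also have "\<dots> = B * ?S * (real n \<cdot>\<^sub>m N)" using assoc_mult_mat[OF Bc S, of "real n \<cdot>\<^sub>m N" k] N by simp
      also have "\<dots> = real n \<cdot>\<^sub>m N" using BS N by simp
      finally show ?thesis using A B N i Nii by (simp add: xi_def)
    qed
    show "(\<Sum>r<n. P $$ (r, r)) = real n - real k"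
    proof -
      \<comment> \<open>The trace is cyclic, and \<open>C * A\<close> is the identity of size
        \<open>k\<close>.\<close>
      have "(\<Sum>r<n. (A * C) $$ (r, r)) = (\<Sum>r<n. \<Sum>c<k. A $$ (r, c) * C $$ (c, r))"
        using A C by (simp add: scalar_prod_def lessThan_atLeast0)
      also have "\<dots> = (\<Sum>c<k. \<Sum>r<n. C $$ (c, r) * A $$ (r, c))"
        by (subst sum.swap) (simp add: mult.commute)
      also have "\<dots> = (\<Sum>c<k. (C * A) $$ (c, c))"
        using A C by (simp add: scalar_prod_def lessThan_atLeast0)
      also have "\<dots> = real k" unfolding CA by simp
      finally show ?thesis using H A C by (simp add: P_def sum_subtractf)
    qed
  qed
qed

subsection \<open>Coverage in the regression model\<close>

text \<open>Division by \<open>\<sigma> * \<beta>\<close>. Taking \<open>h\<close> as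
  \<open>sigma_hat\<close> or as \<open>\<sigma>\<close> gives the feasible or the known-variance
  interval; \<open>c\<close> is \<open>sqrt n\<close>, so that \<open>c * \<beta>\<close> is
  \<open>xi\<close>.\<close>

lemma hit_standardized_iff:
  fixes z t :: real
  assumes "0 < \<sigma>" "0 < \<beta>"
  shows "hit (c * \<eta>) (a / \<beta>) (t / (\<sigma> * \<beta>)) (h / \<sigma>) ((z - t) / (\<sigma> * \<beta>)) \<longleftrightarrow>
    t \<in> {(if \<bar>z\<bar> > h * (c * \<beta>) * \<eta> then z else 0) - h * a .. (if \<bar>z\<bar> > h * (c * \<beta>) * \<eta> then z else 0) + h * a}"
proof -
  have 1: "\<bar>(z - t) / (\<sigma> * \<beta>) + t / (\<sigma> * \<beta>)\<bar> > h / \<sigma> * (c * \<eta>) \<longleftrightarrow> \<bar>z\<bar> > h * (c * \<beta>) * \<eta>"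
    using assms by (simp add: add_divide_distrib[symmetric] abs_mult field_simps)
  have 2: "\<bar>x / (\<sigma> * \<beta>)\<bar> \<le> h / \<sigma> * (a / \<beta>) \<longleftrightarrow> \<bar>x\<bar> \<le> h * a" for x
    using assms by (simp add: abs_mult field_simps)
  show ?thesis unfolding hit_def 1 2 by auto
qed

text \<open>Both intervals share the value \<open>g = limit_cover\<close>, which depends on neither
  \<open>\<theta>\<close> nor \<open>\<sigma>\<close>, and a single \<open>\<theta>\<close> brings
  both coverages near it.\<close>

lemma cover_bounds:
  assumes A: "A \<in> carrier_mat n k" and r: "vec_space.rank n A = k" and i: "i < k" and n: "k < n"
    and \<eta>: "0 < \<eta>" and a: "0 \<le> a" and \<delta>: "0 < \<delta>" "\<delta> \<le> 1 / 2"
    and e: "e = 2 / ((real n - real k) * \<delta>\<^sup>2) + \<delta> * (3 + 2 * (sqrt (real n) * \<eta>))"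
  obtains g where
    "\<And>\<theta> \<sigma>. \<theta> \<in> carrier_vec k \<Longrightarrow> 0 < \<sigma> \<Longrightarrow> g - e \<le> cover_E A \<eta> a i \<theta> \<sigma>"
    "\<And>\<theta> \<sigma>. \<theta> \<in> carrier_vec k \<Longrightarrow> 0 < \<sigma> \<Longrightarrow> g - e \<le> cover_C A \<eta> a i \<theta> \<sigma>"
    "\<And>\<sigma>. 0 < \<sigma> \<Longrightarrow> \<exists>\<theta>\<in>carrier_vec k. cover_E A \<eta> a i \<theta> \<sigma> \<le> g + e \<and> cover_C A \<eta> a i \<theta> \<sigma> \<le> g + e"
proof -
  from n have "0 < n" by simp
  obtain b P where
    LS: "\<And>y. theta_LS A (vec n y) $ i = (\<Sum>j<n. b j * y j)" and
    sh: "\<And>y. sigma_hat A (vec n y) = sqrt ((\<Sum>r<n. (\<Sum>j<n. P r j * y j)\<^sup>2) / (real n - real k))" and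
    unbiased: "\<And>\<theta>. \<theta> \<in> carrier_vec k \<Longrightarrow> (\<Sum>j<n. b j * (A *\<^sub>v \<theta>) $ j) = \<theta> $ i" and
    annih: "\<And>\<theta> r. \<theta> \<in> carrier_vec k \<Longrightarrow> r < n \<Longrightarrow> (\<Sum>j<n. P r j * (A *\<^sub>v \<theta>) $ j) = 0" and
    xi: "xi A i = sqrt (real n * (\<Sum>j<n. (b j)\<^sup>2))" and b_pos: "0 < (\<Sum>j<n. (b j)\<^sup>2)" and
    gram: "\<And>r q. r < n \<Longrightarrow> q < n \<Longrightarrow> (\<Sum>j<n. P r j * P q j) = P r q" and
    trace: "(\<Sum>r<n. P r r) = real n - real k"
    using least_squares_coefficients[OF A r i \<open>0 < n\<close>] by blast
  define \<beta> where "\<beta> = sqrt (\<Sum>j<n. (b j)\<^sup>2)"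
  have \<beta>: "0 < \<beta>" and xi: "xi A i = sqrt (real n) * \<beta>"
    using b_pos by (simp_all add: \<beta>_def xi real_sqrt_mult)
  let ?p = "2 / ((real n - real k) * \<delta>\<^sup>2)"
  let ?T = "sqrt (real n) * \<eta>" and ?\<alpha> = "a / \<beta>"
  have T: "0 < ?T" using \<eta> n by simp
  have \<alpha>: "0 \<le> ?\<alpha>" using a \<beta> by simp
  have dim: "dim_row A = n" using A by simp
  have both: "limit_cover ?T ?\<alpha> - e \<le> cover_E A \<eta> a i \<theta> \<sigma> \<and> limit_cover ?T ?\<alpha> - e \<le> cover_C A \<eta> a i \<theta> \<sigma> \<and>
    (\<theta> $ i / (\<sigma> * \<beta>) = (1 + \<delta>) * ?\<alpha> + \<delta> \<longrightarrow>
      cover_E A \<eta> a i \<theta> \<sigma> \<le> limit_cover ?T ?\<alpha> + e \<and> cover_C A \<eta> a i \<theta> \<sigma> \<le> limit_cover ?T ?\<alpha> + e)"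
    if \<theta>: "\<theta> \<in> carrier_vec k" and \<sigma>: "0 < \<sigma>" for \<theta> \<sigma>
  proof -
    interpret gaussian_vector "{..<n}" "\<lambda>j. (A *\<^sub>v \<theta>) $ j" \<sigma>
      using \<sigma> by unfold_locales auto
    have PG: "P_model A \<theta> \<sigma> = G" by (simp add: P_model_def G_def dim)
    let ?W = "\<lambda>y. ((\<Sum>j<n. b j * y j) - \<theta> $ i) / (\<sigma> * \<beta>)"
    let ?s = "\<lambda>y. sigma_hat A (vec n y) / \<sigma>"
    have D: "distributed G lborel (\<lambda>y. \<Sum>j<n. b j * y j) (normal_density (\<theta> $ i) (\<sigma> * \<beta>))"
      using linear_normal[OF b_pos] unbiased[OF \<theta>] by (simp add: \<beta>_def)
    have W: "distributed G lborel ?W std_normal_density"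
      using D normal_standard_normal_convert[of "\<sigma> * \<beta>" "\<lambda>y. \<Sum>j<n. b j * y j" "\<theta> $ i"] \<sigma> \<beta> by simp
    have s[measurable]: "?s \<in> borel_measurable G" unfolding sh by measurable
    have center: "(\<Sum>j<n. P r j * (y j - (A *\<^sub>v \<theta>) $ j)) = (\<Sum>j<n. P r j * y j)" if "r < n" for r y
      using annih[OF \<theta> that] by (simp add: algebra_simps sum_subtractf)
    have ps: "prob {y \<in> space G. \<bar>?s y - 1\<bar> > \<delta>} \<le> ?p"
      using projection_concentration[of P "real n - real k" \<delta>] gram trace n \<delta> by (simp add: sh center)
    \<comment> \<open>The known-variance interval is the case of constant ratio 1, whose deviation
      event is empty.\<close>
    have p1: "prob {y \<in> space G. \<bar>1 - 1\<bar> > \<delta>} \<le> ?p"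
      using \<delta> n by simp
    have E: "cover_E A \<eta> a i \<theta> \<sigma> = prob {y \<in> space G. hit ?T ?\<alpha> (\<theta> $ i / (\<sigma> * \<beta>)) (?s y) (?W y)}"
      unfolding cover_E_def PG dim hit_standardized_iff[OF \<sigma> \<beta>] theta_H_feas_def LS xi ..
    have C: "cover_C A \<eta> a i \<theta> \<sigma> = prob {y \<in> space G. hit ?T ?\<alpha> (\<theta> $ i / (\<sigma> * \<beta>)) 1 (?W y)}"
      using hit_standardized_iff[OF \<sigma> \<beta>, of "sqrt (real n)" \<eta> a "\<theta> $ i" \<sigma>] \<sigma>
      unfolding cover_C_def PG dim theta_H_def LS xi by simp
    show ?thesis
      unfolding E C e using prob_hit_lower[OF W s ps \<delta> T \<alpha>] prob_hit_lower[OF W _ p1 \<delta> T \<alpha>]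
        prob_hit_upper[OF W s ps \<delta> T \<alpha>] prob_hit_upper[OF W _ p1 \<delta> T \<alpha>] by simp
  qed
  show thesis
  proof (rule that)
    fix \<sigma> :: real assume \<sigma>: "0 < \<sigma>"
    \<comment> \<open>Only coordinate \<open>i\<close> matters; its standardized value is the
      \<open>v\<close> of \<open>prob_hit_upper\<close>.\<close>
    let ?\<theta> = "((1 + \<delta>) * ?\<alpha> + \<delta>) * (\<sigma> * \<beta>) \<cdot>\<^sub>v unit_vec k i"
    have "?\<theta> \<in> carrier_vec k" "?\<theta> $ i / (\<sigma> * \<beta>) = (1 + \<delta>) * ?\<alpha> + \<delta>"
      using \<sigma> \<beta> i by simp_all
    then show "\<exists>\<theta>\<in>carrier_vec k. cover_E A \<eta> a i \<theta> \<sigma> \<le> limit_cover ?T ?\<alpha> + e \<and> cover_C A \<eta> a i \<theta> \<sigma> \<le> limit_cover ?T ?\<alpha> + e"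
      using both[OF _ \<sigma>] by blast
  qed (use both in blast)+
qed

section \<open>From uniform coverage bounds to infima and the limit\<close>

lemma INF_near:
  fixes f :: "'a \<Rightarrow> real"
  assumes lower: "\<And>x. x \<in> S \<Longrightarrow> g - e \<le> f x" and x: "x \<in> S" "f x \<le> g + e"
  shows "\<bar>(INF x\<in>S. f x) - g\<bar> \<le> e"
proof -
  have "g - e \<le> (INF x\<in>S. f x)" using lower x by (intro cINF_greatest) auto
  moreover have "(INF x\<in>S. f x) \<le> f x" using lower x by (intro cINF_lower bdd_belowI2)
  ultimately show ?thesis using x by linarith
qed

lemma inf_coverage_diff_le:
  assumes A: "A \<in> carrier_mat n k" and r: "vec_space.rank n A = k" and i: "i < k" and n: "k < n"
    and \<eta>: "0 < \<eta>" and a: "0 \<le> a" and \<delta>: "0 < \<delta>" "\<delta> \<le> 1 / 2" and \<sigma>: "0 < \<sigma>"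
  shows "\<bar>(INF p \<in> {(theta, s). theta \<in> carrier_vec k \<and> s > 0}. cover_E A \<eta> a i (fst p) (snd p))
      - (INF theta \<in> carrier_vec k. cover_C A \<eta> a i theta \<sigma>)\<bar>
    \<le> 2 * (2 / ((real n - real k) * \<delta>\<^sup>2) + \<delta> * (3 + 2 * (sqrt (real n) * \<eta>)))"
proof -
  define e where "e = 2 / ((real n - real k) * \<delta>\<^sup>2) + \<delta> * (3 + 2 * (sqrt (real n) * \<eta>))"
  obtain g where g:
    "\<And>\<theta> \<sigma>. \<theta> \<in> carrier_vec k \<Longrightarrow> 0 < \<sigma> \<Longrightarrow> g - e \<le> cover_E A \<eta> a i \<theta> \<sigma>"
    "\<And>\<theta> \<sigma>. \<theta> \<in> carrier_vec k \<Longrightarrow> 0 < \<sigma> \<Longrightarrow> g - e \<le> cover_C A \<eta> a i \<theta> \<sigma>"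
    "\<And>\<sigma>. 0 < \<sigma> \<Longrightarrow> \<exists>\<theta>\<in>carrier_vec k. cover_E A \<eta> a i \<theta> \<sigma> \<le> g + e \<and> cover_C A \<eta> a i \<theta> \<sigma> \<le> g + e"
    using cover_bounds[OF A r i n \<eta> a \<delta> e_def] by blast
  \<comment> \<open>A near-minimizer at the given \<open>\<sigma>\<close> also serves the infimum
    over pairs, because the lower bound \<open>g - e\<close> is uniform in the scale.\<close>
  obtain \<theta> where \<theta>: "\<theta> \<in> carrier_vec k" "cover_E A \<eta> a i \<theta> \<sigma> \<le> g + e" "cover_C A \<eta> a i \<theta> \<sigma> \<le> g + e"
    using g(3)[OF \<sigma>] by blast
  have "\<bar>(INF p \<in> {(theta, s). theta \<in> carrier_vec k \<and> s > 0}. cover_E A \<eta> a i (fst p) (snd p)) - g\<bar> \<le> e"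
    using g(1) \<theta> \<sigma> by (intro INF_near[of _ _ _ _ "(\<theta>, \<sigma>)"]) auto
  moreover have "\<bar>(INF theta \<in> carrier_vec k. cover_C A \<eta> a i theta \<sigma>) - g\<bar> \<le> e"
    using g(2) \<theta> \<sigma> by (intro INF_near[of _ _ _ _ \<theta>]) auto
  moreover have "\<bar>x - y\<bar> \<le> 2 * e" if "\<bar>x - g\<bar> \<le> e" "\<bar>y - g\<bar> \<le> e" for x y :: real
    using that by linarith
  ultimately show ?thesis unfolding e_def by blast
qed

theorem theorem15:
  fixes X :: "nat \<Rightarrow> real mat" and k :: "nat \<Rightarrow> nat" and i :: nat
    and eta a :: "nat \<Rightarrow> real" and sig :: real
  assumes model: "\<forall>\<^sub>F n in sequentially. k n \<ge> 1 \<and> X n \<in> carrier_mat n (k n)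
                     \<and> vec_space.rank n (X n) = k n"
    and standing: "\<exists>B. \<forall>\<^sub>F n in sequentially. (xi (X n) i)\<^sup>2 / real n \<le> B"
    and i_le_k: "\<forall>\<^sub>F n in sequentially. i < k n"
    and eta_pos: "\<And>n. eta n > 0"
    and lim_xi_eta: "(\<lambda>n. xi (X n) i * eta n) \<longlonglongrightarrow> 0"
    and lim_nk: "filterlim (\<lambda>n. real n - real (k n)) at_top sequentially"
    and lim_eta: "(\<lambda>n. sqrt (real n) * eta n / sqrt (real n - real (k n))) \<longlonglongrightarrow> 0"
    and a_nonneg: "\<And>n. a n \<ge> 0"
    and sigma_pos: "sig > 0"
  shows "(\<lambda>n. (INF p \<in> {(theta, s). theta \<in> carrier_vec (k n) \<and> s > 0}.
                   cover_E (X n) (eta n) (a n) i (fst p) (snd p))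
            - (INF theta \<in> carrier_vec (k n). cover_C (X n) (eta n) (a n) i theta sig))
         \<longlonglongrightarrow> 0"
proof (rule tendstoI, unfold dist_real_def diff_0_right)
  fix \<epsilon> :: real assume \<epsilon>: "0 < \<epsilon>"
  \<comment> \<open>With \<open>\<delta> = c / sqrt (n - k)\<close> the Chebyshev term is
    \<open>2 / c^2\<close>, and this \<open>c\<close> makes its doubled value
    \<open>\<epsilon> / 2\<close>.\<close>
  define c where "c = sqrt (8 / \<epsilon>)"
  have c: "0 < c" "2 * (2 / c\<^sup>2) = \<epsilon> / 2" using \<epsilon> by (simp_all add: c_def)
  let ?m = "\<lambda>n. real n - real (k n)"
  have sqrt_m: "filterlim (\<lambda>n. sqrt (?m n)) at_top sequentially"
    by (rule filterlim_compose[OF sqrt_at_top lim_nk])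
  have \<delta>0: "(\<lambda>n. c / sqrt (?m n)) \<longlonglongrightarrow> 0"
    by (rule real_tendsto_divide_at_top[OF tendsto_const sqrt_m])
  \<comment> \<open>For fixed \<open>c\<close> the rest of the error vanishes:
    \<open>\<delta> * T\<close> is \<open>c\<close> times the sequence in
    \<open>lim_eta\<close>.\<close>
  have "(\<lambda>n. 2 * (3 * (c / sqrt (?m n)) + 2 * c * (sqrt (real n) * eta n / sqrt (?m n)))) \<longlonglongrightarrow> 2 * (3 * 0 + 2 * c * 0)"
    by (intro tendsto_intros \<delta>0 lim_eta)
  then have small: "\<forall>\<^sub>F n in sequentially. 2 * (3 * (c / sqrt (?m n)) + 2 * c * (sqrt (real n) * eta n / sqrt (?m n))) < \<epsilon> / 2"
    using \<epsilon> by (intro order_tendstoD(2)) auto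
  have half: "\<forall>\<^sub>F n in sequentially. c / sqrt (?m n) < 1 / 2"
    by (rule order_tendstoD(2)[OF \<delta>0]) simp
  have pos: "\<forall>\<^sub>F n in sequentially. 0 < ?m n"
    using lim_nk unfolding filterlim_at_top_dense by blast
  show "\<forall>\<^sub>F n in sequentially. \<bar>(INF p \<in> {(theta, s). theta \<in> carrier_vec (k n) \<and> s > 0}.
                   cover_E (X n) (eta n) (a n) i (fst p) (snd p))
            - (INF theta \<in> carrier_vec (k n). cover_C (X n) (eta n) (a n) i theta sig)\<bar> < \<epsilon>"
    using model i_le_k small half pos
  proof eventually_elim
    case (elim n)
    let ?\<delta> = "c / sqrt (?m n)"
    have \<delta>: "0 < ?\<delta>" "?\<delta> \<le> 1 / 2" using elim c by auto
    have "?m n * ?\<delta>\<^sup>2 = c\<^sup>2" using elim by (simp add: power_divide)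
    moreover have "?\<delta> * (3 + 2 * (sqrt (real n) * eta n))
      = 3 * ?\<delta> + 2 * c * (sqrt (real n) * eta n / sqrt (?m n))"
      by (simp add: algebra_simps)
    ultimately show ?case
      using inf_coverage_diff_le[OF _ _ _ _ eta_pos a_nonneg \<delta> sigma_pos, of "X n" n "k n" i n n] elim c(2)
      by auto
  qed
qed

end
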